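(* Let $\Phi:\mathbb{R}^{\kappa}\to\mathbb{R}^{\kappa}$ be defined by $$\Phi(x) = \tfrac{1}{\Delta t_{n+1}} M_h\,(x-\eta^n) + \theta\, F^{n+1}(\mathcal{B}(x)) + (1-\theta)\, F^n(\mathcal{B}(\eta^n)),$$ where $\theta\in[0,1]$, $\Delta t_{n+1}>0$, $\eta^n\in\mathbb{R}^\kappa$ and $s^n,s^{n+1}\in\mathbb{R}$ are given, and $M_h$, $F^n$, $F^{n+1}$, $\mathcal{B}$ are as defined in the context. Then $\Phi$ is a homeomorphism of $\mathbb{R}^\kappa$ onto $\mathbb{R}^\kappa$. In particular, the nonlinear system $$\tfrac{1}{\Delta t_{n+1}} M_h(\eta^{n+1}-\eta^n) = -(1-\theta)\,F^n(\mathcal{B}(\eta^n)) - \theta\, F^{n+1}(\mathcal{B}(\eta^{n+1}))$$ has a unique solution $\eta^{n+1}\in\mathbb{R}^\kappa$.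
   Context: Let $\kappa\in\mathbb{N}$, $\kappa\ge 1$, and $0=x_0<x_1<\dots<x_\kappa=D$, with $T_j=(x_{j-1},x_j)$ and $h_j=x_j-x_{j-1}$ for $j=1,\dots,\kappa$. Data: $k_i^u,k_i^m,k_i^f>0$ and $c_i^f,c_i^u,L_i>0$ for $i=1,\dots,\kappa$. For $u\in\mathbb{R}$ put $k_i(u)=k_i^f$ if $u<0$, $k_i(u)=k_i^m$ if $u=0$, $k_i(u)=k_i^u$ if $u>0$. For $i=1,\dots,\kappa$ define $\beta(\cdot,x_i):\mathbb{R}\to\mathbb{R}$ by $\beta(e,x_i)=e/c_i^f$ for $e\le 0$, $\beta(e,x_i)=0$ for $0<e<L_i$, $\beta(e,x_i)=(e-L_i)/c_i^u$ for $e\ge L_i$. Define $\mathcal{B}:\mathbb{R}^\kappa\to\mathbb{R}^\kappa$ by $\mathcal{B}(\eta)=(\beta(\eta_1,x_1),\dots,\beta(\eta_\kappa,x_\kappa))^T$. For $\gamma=(\gamma_0,\dots,\gamma_\kappa)^T\in\mathbb{R}^{\kappa+1}$ let $u_\gamma$ be the continuous function on $[0,D]$ that is affine on each $T_j$ with $u_\gamma(x_i)=\gamma_i$ for $i=0,\dots,\kappa$. For $j=1,\dots,\kappa$ set $$Q_j(\gamma)=\frac{\gamma_j-\gamma_{j-1}}{h_j}\cdot\frac{1}{h_j}\int_{T_j}k_j(u_\gamma(x))\,dx .$$ Define $F:\mathbb{R}^{\kappa+1}\to\mathbb{R}^\kappa$ by $F_i(\gamma)=Q_i(\gamma)-Q_{i+1}(\gamma)$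 for $1\le i<\kappa$ and $F_\kappa(\gamma)=Q_\kappa(\gamma)$. For each time index $m$ (here $m=n$ or $m=n+1$), with $s^m\in\mathbb{R}$ the Dirichlet boundary value at time $t_m$, define $F^m:\mathbb{R}^\kappa\to\mathbb{R}^\kappa$ by $F^m(x)=F\big((s^m,x_1,\dots,x_\kappa)^T\big)$ (superscripts are indices, not powers). $M_h\in\mathbb{R}^{\kappa\times\kappa}$ is the diagonal matrix with $(M_h)_{ii}=\tfrac{h_i+h_{i+1}}{2}$ for $1\le i<\kappa$ and $(M_h)_{\kappa\kappa}=\tfrac{h_\kappa}{2}$. *)

theory Defs
  imports "HOL-Analysis.Analysis"
begin

text \<open>
  A vector \<open>(v\<^sub>m, \<dots>, v\<^sub>n)\<close> is an extensional function on the index set \<open>{m..n}\<close>. The space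
  \<open>\<real>\<^sup>\<kappa>\<close> is \<open>powertop_real {1..\<kappa>}\<close>, whose carrier is \<open>{1..\<kappa>} \<rightarrow>\<^sub>E UNIV\<close>, and \<open>\<real>\<^sup>\<kappa>\<^sup>+\<^sup>1\<close>
  is indexed by \<open>{0..\<kappa>}\<close>. Indices are thus those of the nodes \<open>X 0 < \<dots> < X \<kappa>\<close>, and every
  quantity with index \<open>j\<close> that belongs to an element belongs to \<open>T\<^sub>j = {X (j - 1)<..<X j}\<close>.
\<close>

abbreviation Rvec :: "nat \<Rightarrow> (nat \<Rightarrow> real) topology" where
  "Rvec \<kappa> \<equiv> powertop_real {1..\<kappa>}"

definition elem :: "(nat \<Rightarrow> real) \<Rightarrow> nat \<Rightarrow> real set" where
  "elem X j = {X (j - 1)<..<X j}"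

definition hlen :: "(nat \<Rightarrow> real) \<Rightarrow> nat \<Rightarrow> real" where
  "hlen X j = X j - X (j - 1)"

definition kcond ::
  "(nat \<Rightarrow> real) \<Rightarrow> (nat \<Rightarrow> real) \<Rightarrow> (nat \<Rightarrow> real) \<Rightarrow> nat \<Rightarrow> real \<Rightarrow> real" where
  "kcond ku km kf i u = (if u < 0 then kf i else if u = 0 then km i else ku i)"

definition beta ::
  "(nat \<Rightarrow> real) \<Rightarrow> (nat \<Rightarrow> real) \<Rightarrow> (nat \<Rightarrow> real) \<Rightarrow> real \<Rightarrow> nat \<Rightarrow> real" where
  "beta cf cu L e i = (if e \<le> 0 then e / cf i else if e < L i then 0 else (e - L i) / cu i)"

definition Bmap ::
  "nat \<Rightarrow> (nat \<Rightarrow> real) \<Rightarrow> (nat \<Rightarrow> real) \<Rightarrow> (nat \<Rightarrow> real) \<Rightarrow> (nat \<Rightarrow> real) \<Rightarrow> nat \<Rightarrow> real" where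
  "Bmap \<kappa> cf cu L \<eta> = (\<lambda>i\<in>{1..\<kappa>}. beta cf cu L (\<eta> i) i)"

definition is_interpolant ::
  "nat \<Rightarrow> (nat \<Rightarrow> real) \<Rightarrow> (nat \<Rightarrow> real) \<Rightarrow> (real \<Rightarrow> real) \<Rightarrow> bool" where
  "is_interpolant \<kappa> X \<gamma> u \<longleftrightarrow>
     u \<in> extensional {X 0..X \<kappa>} \<and>
     continuous_on {X 0..X \<kappa>} u \<and>
     (\<forall>j\<in>{1..\<kappa>}. \<exists>a b. \<forall>x\<in>elem X j. u x = a * x + b) \<and>
     (\<forall>i\<in>{0..\<kappa>}. u (X i) = \<gamma> i)"

definition interpolant :: "nat \<Rightarrow> (nat \<Rightarrow> real) \<Rightarrow> (nat \<Rightarrow> real) \<Rightarrow> real \<Rightarrow> real" where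
  "interpolant \<kappa> X \<gamma> = (THE u. is_interpolant \<kappa> X \<gamma> u)"

definition Qflux ::
  "nat \<Rightarrow> (nat \<Rightarrow> real) \<Rightarrow> (nat \<Rightarrow> real) \<Rightarrow> (nat \<Rightarrow> real) \<Rightarrow> (nat \<Rightarrow> real) \<Rightarrow>
   nat \<Rightarrow> (nat \<Rightarrow> real) \<Rightarrow> real" where
  "Qflux \<kappa> X ku km kf j \<gamma> =
     (\<gamma> j - \<gamma> (j - 1)) / hlen X j *
     (1 / hlen X j * integral (elem X j) (\<lambda>x. kcond ku km kf j (interpolant \<kappa> X \<gamma> x)))"

definition Fmap ::
  "nat \<Rightarrow> (nat \<Rightarrow> real) \<Rightarrow> (nat \<Rightarrow> real) \<Rightarrow> (nat \<Rightarrow> real) \<Rightarrow> (nat \<Rightarrow> real) \<Rightarrow>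
   (nat \<Rightarrow> real) \<Rightarrow> nat \<Rightarrow> real" where
  "Fmap \<kappa> X ku km kf \<gamma> = (\<lambda>i\<in>{1..\<kappa>}.
     if i < \<kappa> then Qflux \<kappa> X ku km kf i \<gamma> - Qflux \<kappa> X ku km kf (i + 1) \<gamma>
     else Qflux \<kappa> X ku km kf \<kappa> \<gamma>)"

text \<open>For \<open>x \<in> \<real>\<^sup>\<kappa>\<close>, the vector \<open>(s, x\<^sub>1, \<dots>, x\<^sub>\<kappa>)\<close> with indices \<open>0, \<dots>, \<kappa>\<close> is \<open>x(0 := s)\<close>.\<close>

definition FDir ::
  "nat \<Rightarrow> (nat \<Rightarrow> real) \<Rightarrow> (nat \<Rightarrow> real) \<Rightarrow> (nat \<Rightarrow> real) \<Rightarrow> (nat \<Rightarrow> real) \<Rightarrow>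
   real \<Rightarrow> (nat \<Rightarrow> real) \<Rightarrow> nat \<Rightarrow> real" where
  "FDir \<kappa> X ku km kf s x = Fmap \<kappa> X ku km kf (x(0 := s))"

definition Mh :: "nat \<Rightarrow> (nat \<Rightarrow> real) \<Rightarrow> nat \<Rightarrow> nat \<Rightarrow> real" where
  "Mh \<kappa> X i j =
     (if i = j then if i < \<kappa> then (hlen X i + hlen X (i + 1)) / 2 else hlen X \<kappa> / 2 else 0)"

definition mat_vec :: "nat \<Rightarrow> (nat \<Rightarrow> nat \<Rightarrow> real) \<Rightarrow> (nat \<Rightarrow> real) \<Rightarrow> nat \<Rightarrow> real" where
  "mat_vec \<kappa> A v = (\<lambda>i\<in>{1..\<kappa>}. \<Sum>j\<in>{1..\<kappa>}. A i j * v j)"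

text \<open>The description of \<open>u\<^sub>\<gamma>\<close> in \<open>interpolant\<close> determines it.\<close>

lemma mesh_mono:
  fixes X :: "nat \<Rightarrow> real"
  assumes "\<And>j. j \<in> {1..\<kappa>} \<Longrightarrow> X (j - 1) < X j" "i \<le> j" "j \<le> \<kappa>"
  shows "X i \<le> X j"
  using assms(2,3)
proof (induction j rule: dec_induct)
  case (step n)
  then show ?case using assms(1)[of "Suc n"] by simp
qed simp

lemma mesh_cover:
  fixes X :: "nat \<Rightarrow> real"
  assumes "x \<in> {X 0..X \<kappa>}" "1 \<le> \<kappa>"
  shows "\<exists>j\<in>{1..\<kappa>}. x \<in> {X (j - 1)..X j}"
  using assms(2,1)
proof (induction \<kappa> rule: dec_induct)
  case base
  then show ?case by auto
next
  case (step n)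
  show ?case
  proof (cases "x \<le> X n")
    case True
    then obtain j where "j \<in> {1..n}" "x \<in> {X (j - 1)..X j}"
      using step by auto
    then show ?thesis by (intro bexI[of _ j]) auto
  next
    case False
    then show ?thesis using step.prems by (intro bexI[of _ "Suc n"]) auto
  qed
qed

lemma is_interpolant_on_elem:
  assumes mesh: "\<And>j. j \<in> {1..\<kappa>} \<Longrightarrow> X (j - 1) < X j"
    and u: "is_interpolant \<kappa> X \<gamma> u"
    and j: "j \<in> {1..\<kappa>}" and x: "x \<in> {X (j - 1)..X j}"
  shows "u x = \<gamma> (j - 1) + (\<gamma> j - \<gamma> (j - 1)) / hlen X j * (x - X (j - 1))"
proof -
  have lt: "X (j - 1) < X j" using mesh[OF j] .
  have sub: "{X (j - 1)..X j} \<subseteq> {X 0..X \<kappa>}"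
    using mesh_mono[of \<kappa> X 0 "j - 1"] mesh_mono[of \<kappa> X j \<kappa>] mesh j by auto
  obtain a b where ab: "\<And>y. y \<in> elem X j \<Longrightarrow> u y = a * y + b"
    using u j unfolding is_interpolant_def by blast
  have cl: "closure (elem X j) = {X (j - 1)..X j}"
    using lt by (simp add: elem_def)
  have "continuous_on {X 0..X \<kappa>} u"
    using u by (simp add: is_interpolant_def)
  then have "continuous_on (closure (elem X j)) (\<lambda>y. u y - (a * y + b))"
    unfolding cl by (intro continuous_intros) (rule continuous_on_subset[OF _ sub])
  then have eq: "u y = a * y + b" if "y \<in> {X (j - 1)..X j}" for y
    using continuous_constant_on_closure[of "elem X j" "\<lambda>y. u y - (a * y + b)" 0 y] that ab cl
    by auto
  have "u (X (j - 1)) = \<gamma> (j - 1)" "u (X j) = \<gamma> j"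
    using u j unfolding is_interpolant_def by auto
  with eq[of "X (j - 1)"] eq[of "X j"] lt
  have e1: "\<gamma> (j - 1) = a * X (j - 1) + b" and e2: "\<gamma> j = a * X j + b" by auto
  have "(\<gamma> j - \<gamma> (j - 1)) / hlen X j = a"
    using lt unfolding e1 e2 hlen_def by (simp add: field_simps)
  then show ?thesis using eq[OF x] e1 by (simp add: algebra_simps)
qed

lemma is_interpolant_exists:
  assumes mesh: "\<And>j. j \<in> {1..\<kappa>} \<Longrightarrow> X (j - 1) < X j" and \<kappa>: "1 \<le> \<kappa>"
  shows "\<exists>u. is_interpolant \<kappa> X \<gamma> u"
proof -
  define g where "g i x = (\<gamma> i - \<gamma> (i - 1)) / hlen X i *
    (max (X (i - 1)) (min x (X i)) - X (i - 1))" for i x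
  define v where "v x = \<gamma> 0 + (\<Sum>i\<in>{1..\<kappa>}. g i x)" for x
  have cell: "v x = \<gamma> (j - 1) + (\<gamma> j - \<gamma> (j - 1)) / hlen X j * (x - X (j - 1))"
    if j: "j \<in> {1..\<kappa>}" and x: "x \<in> {X (j - 1)..X j}" for j x
  proof -
    have lo: "g i x = \<gamma> i - \<gamma> (i - 1)" if i: "i \<in> {1..j - 1}" for i
    proof -
      have "X i \<le> X (j - 1)" "X (i - 1) < X i"
        using mesh_mono[of \<kappa> X i "j - 1"] mesh i j by auto
      moreover from this have "min x (X i) = X i" using x by simp
      ultimately show ?thesis by (simp add: g_def hlen_def)
    qed
    have hi: "g i x = 0" if i: "i \<in> {j + 1..\<kappa>}" for i
    proof -
      have "X j \<le> X (i - 1)" "X (i - 1) < X i"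
        using mesh_mono[of \<kappa> X j "i - 1"] mesh i j by auto
      then show ?thesis using x by (simp add: g_def min_def max_def)
    qed
    have tel: "(\<Sum>i\<in>{1..n}. \<gamma> i - \<gamma> (i - 1)) = \<gamma> n - \<gamma> 0" for n
      by (induction n) auto
    have "{1..\<kappa>} = {1..j - 1} \<union> {j} \<union> {j + 1..\<kappa>}" using j by auto
    then have "(\<Sum>i\<in>{1..\<kappa>}. g i x) = (\<Sum>i\<in>{1..j - 1} \<union> {j} \<union> {j + 1..\<kappa>}. g i x)" by simp
    also have "\<dots> = (\<Sum>i\<in>{1..j - 1}. g i x) + g j x + (\<Sum>i\<in>{j + 1..\<kappa>}. g i x)"
      using j by (subst sum.union_disjoint; (subst sum.union_disjoint)?) auto
    also have "\<dots> = \<gamma> (j - 1) - \<gamma> 0 + g j x"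
      using lo hi tel[of "j - 1"] by simp
    finally show ?thesis using x by (simp add: v_def g_def min_def max_def)
  qed
  have cont: "continuous_on S v" for S
    unfolding v_def g_def by (intro continuous_intros)
  have node: "v (X i) = \<gamma> i" if "i \<in> {0..\<kappa>}" for i
  proof (cases "i = 0")
    case True
    then show ?thesis using cell[of 1 "X 0"] mesh[of 1] \<kappa> by simp
  next
    case False
    then show ?thesis using cell[of i "X i"] mesh[of i] that by (simp add: hlen_def)
  qed
  have sub: "elem X j \<subseteq> {X 0..X \<kappa>}" if "j \<in> {1..\<kappa>}" for j
    using mesh_mono[of \<kappa> X 0 "j - 1"] mesh_mono[of \<kappa> X j \<kappa>] mesh that
    by (fastforce simp: elem_def)
  have rng: "X i \<in> {X 0..X \<kappa>}" if "i \<in> {0..\<kappa>}" for i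
    using mesh_mono[of \<kappa> X 0 i] mesh_mono[of \<kappa> X i \<kappa>] mesh that by auto
  have aff: "\<exists>a b. \<forall>x\<in>elem X j. restrict v {X 0..X \<kappa>} x = a * x + b"
    if j: "j \<in> {1..\<kappa>}" for j
  proof -
    define m where "m = (\<gamma> j - \<gamma> (j - 1)) / hlen X j"
    have "restrict v {X 0..X \<kappa>} x = m * x + (\<gamma> (j - 1) - m * X (j - 1))"
      if x: "x \<in> elem X j" for x
    proof -
      have "x \<in> {X (j - 1)..X j}" using x by (simp add: elem_def)
      from cell[OF j this] have "v x = m * x + (\<gamma> (j - 1) - m * X (j - 1))"
        unfolding m_def[symmetric] by (simp add: right_diff_distrib)
      then show ?thesis using sub[OF j] x by auto
    qed
    then show ?thesis by blast
  qed
  have "is_interpolant \<kappa> X \<gamma> (restrict v {X 0..X \<kappa>})"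
    unfolding is_interpolant_def
  proof (intro conjI ballI)
    show "continuous_on {X 0..X \<kappa>} (restrict v {X 0..X \<kappa>})"
      by (rule continuous_on_eq[OF cont]) simp
    show "restrict v {X 0..X \<kappa>} (X i) = \<gamma> i" if "i \<in> {0..\<kappa>}" for i
      using node[OF that] rng[OF that] by simp
  qed (fact restrict_extensional, fact aff)
  then show ?thesis by blast
qed

lemma interpolant_ex1:
  assumes mesh: "\<And>j. j \<in> {1..\<kappa>} \<Longrightarrow> X (j - 1) < X j" and \<kappa>: "1 \<le> \<kappa>"
  shows "\<exists>!u. is_interpolant \<kappa> X \<gamma> u"
proof (rule ex_ex1I)
  show "\<exists>u. is_interpolant \<kappa> X \<gamma> u" by (rule is_interpolant_exists) (fact mesh, fact \<kappa>)
next
  fix u w assume u: "is_interpolant \<kappa> X \<gamma> u" and w: "is_interpolant \<kappa> X \<gamma> w"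
  show "u = w"
  proof (rule extensionalityI[of _ "{X 0..X \<kappa>}"])
    fix x assume "x \<in> {X 0..X \<kappa>}"
    then obtain j where "j \<in> {1..\<kappa>}" "x \<in> {X (j - 1)..X j}"
      using mesh_cover \<kappa> by blast
    then show "u x = w x"
      using is_interpolant_on_elem[OF mesh u] is_interpolant_on_elem[OF mesh w] by simp
  qed (use u w in \<open>auto simp: is_interpolant_def\<close>)
qed

lemma is_interpolant_interpolant:
  assumes "\<And>j. j \<in> {1..\<kappa>} \<Longrightarrow> X (j - 1) < X j" "1 \<le> \<kappa>"
  shows "is_interpolant \<kappa> X \<gamma> (interpolant \<kappa> X \<gamma>)"
proof -
  have "\<exists>!u. is_interpolant \<kappa> X \<gamma> u"
    by (rule interpolant_ex1) (fact assms)+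
  then show ?thesis
    unfolding interpolant_def by (rule theI')
qed

end

theory Submission
  imports Defs
begin

text \<open>
  Integrating \<open>k\<^sub>j\<close> along the affine piece turns the flux into a difference quotient:
  \<open>Q\<^sub>j(\<gamma>) = (K\<^sub>j(\<gamma>\<^sub>j) - K\<^sub>j(\<gamma>\<^sub>j\<^sub>-\<^sub>1)) / h\<^sub>j\<close>, where \<open>K\<^sub>j\<close> (below \<open>kprim\<close>) is the primitive of \<open>k\<^sub>j\<close>
  that vanishes at \<open>0\<close>; the values \<open>k\<^sub>j\<^sup>m\<close> play no role. As \<open>K\<^sub>j\<close> and \<open>\<beta>\<close> are nondecreasing and
  Lipschitz, \<open>\<Phi>\<^sub>i(x) = a\<^sub>i x\<^sub>i + g\<^sub>i(x\<^sub>i) - (\<Sum>j. p\<^sub>i\<^sub>j(x\<^sub>j)) + c\<^sub>i\<close> with nondecreasing \<open>p\<^sub>i\<^sub>j\<close> whose column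
  sums grow no faster than \<open>g\<^sub>j\<close>: a flux that leaves one node enters its neighbour or the
  boundary. For small \<open>\<epsilon> > 0\<close> this column dominance makes \<open>x \<mapsto> x - \<epsilon> \<Phi>(x)\<close> a contraction in the
  \<open>\<ell>\<^sup>1\<close> metric, so \<open>\<Phi>\<close> is onto by Banach's fixed point theorem, and \<open>\<Phi>\<close> and its inverse are Lipschitz.
\<close>

section \<open>The l1 metric on finite families of reals, and its completeness\<close>

definition dist1 :: "'i set \<Rightarrow> ('i \<Rightarrow> real) \<Rightarrow> ('i \<Rightarrow> real) \<Rightarrow> real" where
  "dist1 I x y = (\<Sum>i\<in>I. \<bar>x i - y i\<bar>)"

lemma dist1_nonneg: "0 \<le> dist1 I x y"
  by (simp add: dist1_def sum_nonneg)

lemma abs_component_le_dist1: "finite I \<Longrightarrow> i \<in> I \<Longrightarrow> \<bar>x i - y i\<bar> \<le> dist1 I x y"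
  unfolding dist1_def by (rule member_le_sum) auto

lemma dist1_eq_0_imp_eq:
  assumes "finite I" "x \<in> I \<rightarrow>\<^sub>E UNIV" "y \<in> I \<rightarrow>\<^sub>E UNIV" "dist1 I x y = 0"
  shows "x = y"
proof (rule PiE_ext[OF assms(2,3)])
  show "x i = y i" if "i \<in> I" for i
    using abs_component_le_dist1[OF assms(1) that, of x y] assms(4) by simp
qed

lemma Metric_space_dist1:
  assumes "finite I"
  shows "Metric_space (I \<rightarrow>\<^sub>E UNIV) (dist1 I)"
proof
  show "dist1 I x y = 0 \<longleftrightarrow> x = y" if "x \<in> I \<rightarrow>\<^sub>E UNIV" "y \<in> I \<rightarrow>\<^sub>E UNIV" for x y
    using dist1_eq_0_imp_eq[OF assms that] by (auto simp: dist1_def)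
  show "dist1 I x z \<le> dist1 I x y + dist1 I y z" for x y z
    unfolding dist1_def by (subst sum.distrib[symmetric]) (rule sum_mono, simp)
qed (auto simp: dist1_nonneg, simp add: dist1_def abs_minus_commute)

text \<open>Each coordinate of a Cauchy sequence is Cauchy in the reals; finiteness of
  \<open>I\<close> turns the coordinatewise limits into a limit in the l1 metric.\<close>

lemma mcomplete_dist1:
  fixes I :: "'i set"
  assumes I: "finite I"
  shows "Metric_space.mcomplete (I \<rightarrow>\<^sub>E UNIV) (dist1 I)"
proof -
  interpret Metric_space "I \<rightarrow>\<^sub>E UNIV" "dist1 I"
    by (rule Metric_space_dist1[OF I])
  show ?thesis
    unfolding mcomplete_def
  proof (intro allI impI)
    fix \<sigma> :: "nat \<Rightarrow> 'i \<Rightarrow> real"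
    assume \<sigma>: "MCauchy \<sigma>"
    have "Cauchy (\<lambda>n. \<sigma> n i)" if i: "i \<in> I" for i
    proof (rule CauchyI)
      fix e :: real assume "0 < e"
      then obtain N where N: "\<And>m n. N \<le> m \<Longrightarrow> N \<le> n \<Longrightarrow> dist1 I (\<sigma> m) (\<sigma> n) < e"
        using \<sigma> unfolding MCauchy_def by meson
      have "norm (\<sigma> m i - \<sigma> n i) < e" if "N \<le> m" "N \<le> n" for m n
        using N[OF that] abs_component_le_dist1[OF I i, of "\<sigma> m" "\<sigma> n"] by simp
      then show "\<exists>N. \<forall>m\<ge>N. \<forall>n\<ge>N. norm (\<sigma> m i - \<sigma> n i) < e" by blast
    qed
    then have "\<forall>i\<in>I. \<exists>l. (\<lambda>n. \<sigma> n i) \<longlonglongrightarrow> l"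
      by (auto simp: Cauchy_convergent_iff convergent_def)
    then obtain l where l: "\<And>i. i \<in> I \<Longrightarrow> (\<lambda>n. \<sigma> n i) \<longlonglongrightarrow> l i" by metis
    \<comment> \<open>Restricting \<open>l\<close> puts the limit into the extensional carrier
      without changing it on \<open>I\<close>.\<close>
    define z where "z = restrict l I"
    have "(\<lambda>n. dist1 I (\<sigma> n) z) \<longlonglongrightarrow> (\<Sum>i\<in>I. \<bar>l i - z i\<bar>)"
      unfolding dist1_def by (intro tendsto_intros l)
    then have "(\<lambda>n. dist1 I (\<sigma> n) z) \<longlonglongrightarrow> 0"
      by (simp add: z_def)
    then have lim: "\<exists>N. \<forall>n\<ge>N. dist1 I (\<sigma> n) z < e" if "0 < e" for e
      using that by (auto simp: eventually_sequentially dest: order_tendstoD(2))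
    have "range \<sigma> \<subseteq> I \<rightarrow>\<^sub>E UNIV" using \<sigma> by (simp add: MCauchy_def)
    then have "limitin mtopology \<sigma> z sequentially"
      unfolding limit_metric_sequentially using lim by (auto simp: z_def range_subsetD)
    then show "\<exists>z. limitin mtopology \<sigma> z sequentially" by blast
  qed
qed

section \<open>Lipschitz maps and homeomorphisms of real product spaces\<close>

lemma continuous_map_dist1_lipschitz:
  assumes I: "finite I"
    and f: "f \<in> (I \<rightarrow>\<^sub>E UNIV) \<rightarrow> (I \<rightarrow>\<^sub>E UNIV)"
    and lip: "\<And>x y. x \<in> I \<rightarrow>\<^sub>E UNIV \<Longrightarrow> y \<in> I \<rightarrow>\<^sub>E UNIV \<Longrightarrow> dist1 I (f x) (f y) \<le> C * dist1 I x y"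
  shows "continuous_map (powertop_real I) (powertop_real I) f"
proof -
  have "continuous_map (powertop_real I) Met_TC.mtopology (\<lambda>x. f x k)" if k: "k \<in> I" for k
    unfolding Met_TC.continuous_map_to_metric
  proof (intro ballI allI impI)
    fix x e assume "x \<in> topspace (powertop_real I)" and e: "0 < (e::real)"
    then have x: "x \<in> I \<rightarrow>\<^sub>E UNIV" by simp
    \<comment> \<open>The l1 distance to \<open>x\<close> is continuous in the product topology, so
      \<open>U\<close> is an open neighbourhood of \<open>x\<close> on which the Lipschitz bound
      stays below \<open>e\<close>. The factor \<open>\<bar>C\<bar>\<close> dominates
      \<open>C\<close> for either sign.\<close>
    define U where "U = {y \<in> topspace (powertop_real I). \<bar>C\<bar> * dist1 I y x \<in> {..<e}}"
    have "continuous_map (powertop_real I) euclideanreal (\<lambda>y. \<bar>C\<bar> * dist1 I y x)"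
      unfolding dist1_def by (intro continuous_intros I) auto
    then have "openin (powertop_real I) U"
      unfolding U_def by (rule openin_continuous_map_preimage) simp
    moreover have "x \<in> U" using x e by (simp add: U_def dist1_def)
    moreover have "f y \<in> I \<rightarrow>\<^sub>E UNIV \<and> \<bar>f y k - f x k\<bar> < e" if "y \<in> U" for y
    proof -
      have y: "y \<in> I \<rightarrow>\<^sub>E UNIV" and d: "\<bar>C\<bar> * dist1 I y x < e" using that by (auto simp: U_def)
      have "\<bar>f y k - f x k\<bar> \<le> dist1 I (f y) (f x)" by (rule abs_component_le_dist1[OF I k])
      also have "\<dots> \<le> C * dist1 I y x" by (rule lip[OF y x])
      also have "\<dots> \<le> \<bar>C\<bar> * dist1 I y x" by (intro mult_right_mono dist1_nonneg) auto
      finally show ?thesis using d y f by auto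
    qed
    ultimately show "\<exists>U. openin (powertop_real I) U \<and> x \<in> U \<and> (\<forall>y\<in>U. f y k \<in> Met_TC.mball (f x k) e)"
      by (intro exI[of _ U]) (auto simp: dist_real_def abs_minus_commute)
  qed
  then show ?thesis
    unfolding continuous_map_componentwise using f by (auto simp: PiE_def)
qed

text \<open>Solutions of \<open>F x = y\<close> are the fixed points of the relaxed map
  \<open>T\<close> below, a contraction by \<open>contr\<close>. The triangle inequality turns the
  same estimate into Lipschitz bounds for \<open>F\<close> from above and below.\<close>

lemma homeomorphic_map_if_relaxation_contracts:
  fixes F :: "('i \<Rightarrow> real) \<Rightarrow> 'i \<Rightarrow> real"
  assumes I: "finite I" and F: "F \<in> (I \<rightarrow>\<^sub>E UNIV) \<rightarrow> (I \<rightarrow>\<^sub>E UNIV)"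
    and \<epsilon>: "0 < \<epsilon>" and q: "q < 1"
    and contr: "\<And>x y. x \<in> I \<rightarrow>\<^sub>E UNIV \<Longrightarrow> y \<in> I \<rightarrow>\<^sub>E UNIV \<Longrightarrow>
      (\<Sum>i\<in>I. \<bar>x i - y i - \<epsilon> * (F x i - F y i)\<bar>) \<le> q * dist1 I x y"
  shows "homeomorphic_map (powertop_real I) (powertop_real I) F"
proof -
  let ?S = "I \<rightarrow>\<^sub>E (UNIV :: real set)"
  interpret Metric_space ?S "dist1 I"
    by (rule Metric_space_dist1[OF I])
  have upper: "dist1 I (F x) (F y) \<le> (1 + q) / \<epsilon> * dist1 I x y" if "x \<in> ?S" "y \<in> ?S" for x y
  proof -
    have "\<epsilon> * dist1 I (F x) (F y) = (\<Sum>i\<in>I. \<bar>\<epsilon> * (F x i - F y i)\<bar>)"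
      using \<epsilon> by (simp add: dist1_def sum_distrib_left abs_mult)
    also have "\<dots> \<le> (\<Sum>i\<in>I. \<bar>x i - y i\<bar> + \<bar>x i - y i - \<epsilon> * (F x i - F y i)\<bar>)"
      by (intro sum_mono) linarith
    also have "\<dots> \<le> (1 + q) * dist1 I x y"
      using contr[OF that] by (simp add: sum.distrib dist1_def[symmetric] algebra_simps)
    finally show ?thesis using \<epsilon> by (simp add: field_simps)
  qed
  \<comment> \<open>Since \<open>q < 1\<close>, the term \<open>q * dist1 I x y\<close> is absorbed
    on the left. The bound yields both injectivity of \<open>F\<close> and the Lipschitz constant of
    the inverse.\<close>
  have lower: "dist1 I x y \<le> \<epsilon> / (1 - q) * dist1 I (F x) (F y)" if "x \<in> ?S" "y \<in> ?S" for x y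
  proof -
    have "dist1 I x y \<le> (\<Sum>i\<in>I. \<bar>\<epsilon> * (F x i - F y i)\<bar> + \<bar>x i - y i - \<epsilon> * (F x i - F y i)\<bar>)"
      unfolding dist1_def by (intro sum_mono) linarith
    also have "\<dots> \<le> \<epsilon> * dist1 I (F x) (F y) + q * dist1 I x y"
      using contr[OF that] \<epsilon> by (simp add: sum.distrib dist1_def sum_distrib_left abs_mult)
    finally show ?thesis using q by (simp add: field_simps)
  qed
  have "\<exists>x\<in>?S. F x = y" if y: "y \<in> ?S" for y
  proof -
    define T where "T x = (\<lambda>i\<in>I. x i - \<epsilon> * (F x i - y i))" for x
    have "dist1 I (T x) (T x') \<le> q * dist1 I x x'" if "x \<in> ?S" "x' \<in> ?S" for x x'
    proof -
      have "dist1 I (T x) (T x') = (\<Sum>i\<in>I. \<bar>x i - x' i - \<epsilon> * (F x i - F x' i)\<bar>)"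
        unfolding dist1_def T_def by (intro sum.cong) (auto simp: algebra_simps)
      then show ?thesis using contr[OF that] by simp
    qed
    moreover have "T \<in> ?S \<rightarrow> ?S" by (auto simp: T_def)
    moreover have "?S \<noteq> {}" using y by blast
    ultimately obtain x where x: "x \<in> ?S" "T x = x"
      using Banach_fixedpoint_thm[OF mcomplete_dist1[OF I], of T q] q by metis
    have "F x = y"
    proof (rule PiE_ext)
      show "F x \<in> ?S" using F x by blast
      show "F x i = y i" if "i \<in> I" for i
        using fun_cong[OF x(2), of i] that \<epsilon> by (simp add: T_def)
    qed (fact y)
    then show ?thesis using x by blast
  qed
  then obtain G where G: "\<And>y. y \<in> ?S \<Longrightarrow> G y \<in> ?S" "\<And>y. y \<in> ?S \<Longrightarrow> F (G y) = y" by metis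
  have F_S: "F x \<in> ?S" if "x \<in> ?S" for x using F that by blast
  have GF: "G (F x) = x" if x: "x \<in> ?S" for x
  proof (rule dist1_eq_0_imp_eq[OF I])
    have "dist1 I (G (F x)) x \<le> \<epsilon> / (1 - q) * dist1 I (F (G (F x))) (F x)"
      by (intro lower G F_S x)
    also have "\<dots> = 0" using G(2)[OF F_S[OF x]] by (simp add: dist1_def)
    finally show "dist1 I (G (F x)) x = 0" using dist1_nonneg[of I "G (F x)" x] by simp
  qed (use G F_S x in auto)
  have "continuous_map (powertop_real I) (powertop_real I) F"
    using upper by (intro continuous_map_dist1_lipschitz I F)
  moreover have "continuous_map (powertop_real I) (powertop_real I) G"
  proof (rule continuous_map_dist1_lipschitz[OF I])
    show "dist1 I (G x) (G y) \<le> \<epsilon> / (1 - q) * dist1 I x y" if "x \<in> ?S" "y \<in> ?S" for x y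
      using lower[of "G x" "G y"] G that by simp
  qed (use G in blast)
  ultimately have "homeomorphic_maps (powertop_real I) (powertop_real I) F G"
    unfolding homeomorphic_maps_def using G GF by simp
  then show ?thesis using homeomorphic_map_maps by blast
qed

text \<open>Each \<open>p i j\<close> depends on the single unknown \<open>x j\<close>. Summing
  absolute values over the rows and exchanging the sums therefore leaves one scalar estimate per
  column, in which \<open>dom\<close> balances the off-diagonal growth against \<open>g j\<close>
  and \<open>a j\<close> supplies strict contraction.\<close>

lemma homeomorphic_map_column_dominant:
  fixes a c B :: "'i \<Rightarrow> real" and g :: "'i \<Rightarrow> real \<Rightarrow> real" and p :: "'i \<Rightarrow> 'i \<Rightarrow> real \<Rightarrow> real"
  assumes I: "finite I" and a: "\<And>i. i \<in> I \<Longrightarrow> 0 < a i"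
    and p: "\<And>i j. i \<in> I \<Longrightarrow> j \<in> I \<Longrightarrow> mono (p i j)"
    and dom: "\<And>j s t. j \<in> I \<Longrightarrow> s \<le> t \<Longrightarrow> (\<Sum>i\<in>I. p i j t - p i j s) \<le> g j t - g j s"
    and lip: "\<And>j s t. j \<in> I \<Longrightarrow> s \<le> t \<Longrightarrow> g j t - g j s \<le> B j * (t - s)"
    and F: "\<And>x. F x = (\<lambda>i\<in>I. a i * x i + g i (x i) - (\<Sum>j\<in>I. p i j (x j)) + c i)"
  shows "homeomorphic_map (powertop_real I) (powertop_real I) F"
proof -
  \<comment> \<open>Inserting \<open>1\<close> covers empty \<open>I\<close> and ensures
    \<open>1 \<le> A\<close>, so that the step \<open>1 / A\<close> is positive.\<close>
  define \<alpha> where "\<alpha> = Min (insert 1 (a ` I))"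
  define A where "A = Max (insert 1 ((\<lambda>i. a i + B i) ` I))"
  have \<alpha>: "0 < \<alpha>" "\<And>i. i \<in> I \<Longrightarrow> \<alpha> \<le> a i"
    using I a by (auto simp: \<alpha>_def)
  have A: "1 \<le> A" "\<And>i. i \<in> I \<Longrightarrow> a i + B i \<le> A"
    using I by (auto simp: A_def)
  define \<epsilon> where "\<epsilon> = 1 / A"
  have \<epsilon>: "0 < \<epsilon>" and \<epsilon>A: "\<epsilon> * A = 1" using A(1) by (auto simp: \<epsilon>_def)
  text \<open>The step \<open>\<epsilon>\<close> is so small that the diagonal part keeps the sign of the increment; the
    decrease of its absolute value then pays for the off-diagonal terms of the same column.\<close>
  have col: "\<bar>t - s - \<epsilon> * (a j * (t - s) + (g j t - g j s))\<bar> + \<epsilon> * (\<Sum>i\<in>I. \<bar>p i j t - p i j s\<bar>)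
      \<le> (1 - \<epsilon> * \<alpha>) * \<bar>t - s\<bar>" if j: "j \<in> I" and st: "s \<le> t" for j s t
  proof -
    let ?P = "\<Sum>i\<in>I. p i j t - p i j s"
    have P: "(\<Sum>i\<in>I. \<bar>p i j t - p i j s\<bar>) = ?P"
      using monoD[OF p[OF _ j] st] by (intro sum.cong) auto
    have "a j * (t - s) + (g j t - g j s) \<le> (a j + B j) * (t - s)"
      using lip[OF j st] by (simp add: algebra_simps)
    also have "\<dots> \<le> A * (t - s)" using A(2)[OF j] st by (intro mult_right_mono) auto
    finally have "\<epsilon> * (a j * (t - s) + (g j t - g j s)) \<le> \<epsilon> * (A * (t - s))"
      using \<epsilon> by (intro mult_left_mono) auto
    also have "\<dots> = t - s" using \<epsilon>A by (simp flip: mult.assoc)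
    finally have 1: "\<epsilon> * (a j * (t - s) + (g j t - g j s)) \<le> t - s" .
    have "\<alpha> * (t - s) + ?P \<le> a j * (t - s) + (g j t - g j s)"
      using \<alpha>(2)[OF j] dom[OF j st] st by (intro add_mono mult_right_mono) auto
    then have "\<epsilon> * (\<alpha> * (t - s) + ?P) \<le> \<epsilon> * (a j * (t - s) + (g j t - g j s))"
      using \<epsilon> by (intro mult_left_mono) auto
    then have "t - s - \<epsilon> * (a j * (t - s) + (g j t - g j s)) + \<epsilon> * ?P \<le> (1 - \<epsilon> * \<alpha>) * (t - s)"
      by (simp add: algebra_simps)
    then show ?thesis using 1 st P by simp
  qed
  show ?thesis
  proof (rule homeomorphic_map_if_relaxation_contracts[OF I _ \<epsilon>])
    show "1 - \<epsilon> * \<alpha> < 1" using \<epsilon> \<alpha> by simp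
    show "F \<in> (I \<rightarrow>\<^sub>E UNIV) \<rightarrow> (I \<rightarrow>\<^sub>E UNIV)" unfolding F by auto
    fix x y :: "'i \<Rightarrow> real"
    \<comment> \<open>\<open>D\<close> is the diagonal part of the relaxed increment,
      \<open>E\<close> the off-diagonal increment before scaling by
      \<open>\<epsilon>\<close>.\<close>
    define D where "D j = x j - y j - \<epsilon> * (a j * (x j - y j) + (g j (x j) - g j (y j)))" for j
    define E where "E i j = p i j (x j) - p i j (y j)" for i j
    have col': "\<bar>D j\<bar> + \<epsilon> * (\<Sum>i\<in>I. \<bar>E i j\<bar>) \<le> (1 - \<epsilon> * \<alpha>) * \<bar>x j - y j\<bar>" if j: "j \<in> I" for j
    proof (cases "y j \<le> x j")
      case True
      then show ?thesis using col[OF j True] by (simp add: D_def E_def)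
    next
      \<comment> \<open>Exchanging \<open>x j\<close> and \<open>y j\<close> flips the signs of
        \<open>D j\<close> and of every \<open>E i j\<close>, so \<open>col\<close> applies to the
        reversed order.\<close>
      case False
      then have le: "x j \<le> y j" by simp
      have "\<bar>D j\<bar> = \<bar>y j - x j - \<epsilon> * (a j * (y j - x j) + (g j (y j) - g j (x j)))\<bar>"
        unfolding D_def by (subst abs_minus_cancel[symmetric], rule arg_cong[of _ _ abs])
          (simp add: algebra_simps)
      then show ?thesis using col[OF j le] by (simp add: E_def abs_minus_commute)
    qed
    have "(\<Sum>i\<in>I. \<bar>x i - y i - \<epsilon> * (F x i - F y i)\<bar>) = (\<Sum>i\<in>I. \<bar>D i + \<epsilon> * (\<Sum>j\<in>I. E i j)\<bar>)"
      unfolding F D_def E_def by (intro sum.cong refl arg_cong[of _ _ abs])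
        (simp add: sum_subtractf algebra_simps)
    also have "\<dots> \<le> (\<Sum>i\<in>I. \<bar>D i\<bar> + \<epsilon> * (\<Sum>j\<in>I. \<bar>E i j\<bar>))"
    proof (intro sum_mono order_trans[OF abs_triangle_ineq] add_left_mono)
      show "\<bar>\<epsilon> * (\<Sum>j\<in>I. E i j)\<bar> \<le> \<epsilon> * (\<Sum>j\<in>I. \<bar>E i j\<bar>)" for i
        using \<epsilon> by (simp add: abs_mult)
    qed
    \<comment> \<open>The off-diagonal terms are regrouped from rows to columns.\<close>
    also have "\<dots> = (\<Sum>j\<in>I. \<bar>D j\<bar> + \<epsilon> * (\<Sum>i\<in>I. \<bar>E i j\<bar>))"
      unfolding sum.distrib sum_distrib_left by (subst (2) sum.swap) simp
    also have "\<dots> \<le> (\<Sum>j\<in>I. (1 - \<epsilon> * \<alpha>) * \<bar>x j - y j\<bar>)"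
      by (intro sum_mono col')
    finally show "(\<Sum>i\<in>I. \<bar>x i - y i - \<epsilon> * (F x i - F y i)\<bar>) \<le> (1 - \<epsilon> * \<alpha>) * dist1 I x y"
      by (simp add: dist1_def sum_distrib_left)
  qed
qed

section \<open>The primitive of the conductivity and the closed form of the flux\<close>

definition kprim :: "(nat \<Rightarrow> real) \<Rightarrow> (nat \<Rightarrow> real) \<Rightarrow> nat \<Rightarrow> real \<Rightarrow> real" where
  "kprim ku kf i v = ku i * max v 0 + kf i * min v 0"

lemma kprim_deriv:
  assumes "v \<noteq> 0"
  shows "(kprim ku kf i has_real_derivative kcond ku km kf i v) (at v)"
proof (cases "0 < v")
  case True
  have "((\<lambda>v. ku i * v) has_real_derivative ku i) (at v)"
    by (auto intro!: derivative_eq_intros)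
  then have "(kprim ku kf i has_real_derivative ku i) (at v)"
    by (rule has_field_derivative_transform_within_open[where S = "{0<..}"])
      (use True in \<open>auto simp: kprim_def\<close>)
  then show ?thesis using True by (simp add: kcond_def)
next
  case False
  have "((\<lambda>v. kf i * v) has_real_derivative kf i) (at v)"
    by (auto intro!: derivative_eq_intros)
  then have "(kprim ku kf i has_real_derivative kf i) (at v)"
    by (rule has_field_derivative_transform_within_open[where S = "{..<0}"])
      (use False assms in \<open>auto simp: kprim_def\<close>)
  then show ?thesis using False assms by (simp add: kcond_def)
qed

text \<open>On the element the interpolant is an affine \<open>w\<close> of slope \<open>m\<close>,
  so by the chain rule \<open>kprim\<close> along \<open>w\<close> has derivative \<open>m\<close>
  times the conductivity; the fundamental theorem of calculus gives the rest.\<close>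

lemma Qflux_eq:
  assumes mesh: "\<And>j. j \<in> {1..\<kappa>} \<Longrightarrow> X (j - 1) < X j" and j: "j \<in> {1..\<kappa>}"
  shows "Qflux \<kappa> X ku km kf j \<gamma> = (kprim ku kf j (\<gamma> j) - kprim ku kf j (\<gamma> (j - 1))) / hlen X j"
proof -
  define m where "m = (\<gamma> j - \<gamma> (j - 1)) / hlen X j"
  define w where "w x = \<gamma> (j - 1) + m * (x - X (j - 1))" for x
  have lt: "X (j - 1) < X j" using mesh[OF j] .
  have "is_interpolant \<kappa> X \<gamma> (interpolant \<kappa> X \<gamma>)"
    by (rule is_interpolant_interpolant) (use mesh j in auto)
  then have "interpolant \<kappa> X \<gamma> x = w x" if "x \<in> elem X j" for x
    unfolding w_def m_def
    by (intro is_interpolant_on_elem[where \<kappa> = \<kappa>]) (use mesh j that in \<open>auto simp: elem_def\<close>)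
  then have int: "integral (elem X j) (\<lambda>x. kcond ku km kf j (interpolant \<kappa> X \<gamma> x)) =
      integral (elem X j) (\<lambda>x. kcond ku km kf j (w x))"
    by (intro Henstock_Kurzweil_Integration.integral_cong) simp
  have ends: "w (X (j - 1)) = \<gamma> (j - 1)" "w (X j) = \<gamma> j"
    using lt by (auto simp: w_def m_def hlen_def)
  \<comment> \<open>The slope factor of \<open>Qflux\<close> is moved inside the integral, which
    avoids dividing by \<open>m\<close>. For constant \<open>w\<close> both sides are zero.\<close>
  have "integral (elem X j) (\<lambda>x. m * kcond ku km kf j (w x)) =
      kprim ku kf j (\<gamma> j) - kprim ku kf j (\<gamma> (j - 1))"
  proof (cases "m = 0")
    case True
    then have "\<gamma> j = \<gamma> (j - 1)" using lt by (simp add: m_def hlen_def)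
    then show ?thesis using True by simp
  next
    case False
    have "((\<lambda>x. m * kcond ku km kf j (w x)) has_integral
        kprim ku kf j (w (X j)) - kprim ku kf j (w (X (j - 1)))) {X (j - 1)..X j}"
    \<comment> \<open>The exceptional point is the zero of \<open>w\<close>, where
      \<open>kprim\<close> may have a kink; continuity suffices there.\<close>
    proof (rule fundamental_theorem_of_calculus_strong[where S = "{X (j - 1) - \<gamma> (j - 1) / m}"])
      show "continuous_on {X (j - 1)..X j} (\<lambda>x. kprim ku kf j (w x))"
        unfolding kprim_def w_def by (intro continuous_intros)
      fix x assume "x \<in> {X (j - 1)..X j} - {X (j - 1) - \<gamma> (j - 1) / m}"
      then have "w x \<noteq> 0" using False by (auto simp: w_def field_simps)
      moreover have "(w has_real_derivative m) (at x)"
        unfolding w_def by (auto intro!: derivative_eq_intros)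
      ultimately have "((\<lambda>x. kprim ku kf j (w x)) has_real_derivative
          kcond ku km kf j (w x) * m) (at x)"
        by (intro DERIV_chain2 kprim_deriv)
      then show "((\<lambda>x. kprim ku kf j (w x)) has_vector_derivative m * kcond ku km kf j (w x)) (at x)"
        by (simp add: has_real_derivative_iff_has_vector_derivative mult.commute)
    qed (use lt in auto)
    then show ?thesis
      unfolding ends elem_def has_integral_Icc_iff_Ioo by (rule integral_unique)
  qed
  then show ?thesis
    unfolding Qflux_def int m_def[symmetric] by simp
qed

section \<open>Monotonicity and Lipschitz bounds of the nonlinearities\<close>

lemma kprim_increment:
  assumes "0 \<le> ku i" "0 \<le> kf i" "s \<le> t"
  shows "0 \<le> kprim ku kf i t - kprim ku kf i s"
    and "kprim ku kf i t - kprim ku kf i s \<le> (ku i + kf i) * (t - s)"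
proof -
  have "kprim ku kf i t - kprim ku kf i s = ku i * (max t 0 - max s 0) + kf i * (min t 0 - min s 0)"
    by (simp add: kprim_def algebra_simps)
  moreover have "0 \<le> max t 0 - max s 0" "0 \<le> min t 0 - min s 0"
    "max t 0 - max s 0 \<le> t - s" "min t 0 - min s 0 \<le> t - s"
    using assms by auto
  ultimately show "0 \<le> kprim ku kf i t - kprim ku kf i s"
    and "kprim ku kf i t - kprim ku kf i s \<le> (ku i + kf i) * (t - s)"
    using assms by (auto simp: distrib_right intro!: add_nonneg_nonneg add_mono mult_left_mono)
qed

text \<open>\<open>beta\<close> is a positive combination of \<open>min e 0\<close> and
  \<open>max (e - L i) 0\<close>, both nondecreasing and 1-Lipschitz; \<open>0 < L i\<close> keeps
  the two from being nonzero at once.\<close>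

lemma beta_increment:
  assumes "0 < cf i" "0 < cu i" "0 < L i" "s \<le> t"
  shows "0 \<le> beta cf cu L t i - beta cf cu L s i"
    and "beta cf cu L t i - beta cf cu L s i \<le> (1 / cf i + 1 / cu i) * (t - s)"
proof -
  have b: "beta cf cu L e i = 1 / cf i * min e 0 + 1 / cu i * max (e - L i) 0" for e
    using assms(1-3) by (auto simp: beta_def)
  have "beta cf cu L t i - beta cf cu L s i =
      1 / cf i * (min t 0 - min s 0) + 1 / cu i * (max (t - L i) 0 - max (s - L i) 0)"
    unfolding b by (simp add: algebra_simps)
  moreover have "0 \<le> max (t - L i) 0 - max (s - L i) 0" "0 \<le> min t 0 - min s 0"
    "max (t - L i) 0 - max (s - L i) 0 \<le> t - s" "min t 0 - min s 0 \<le> t - s"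
    using assms by auto
  ultimately show "0 \<le> beta cf cu L t i - beta cf cu L s i"
    and "beta cf cu L t i - beta cf cu L s i \<le> (1 / cf i + 1 / cu i) * (t - s)"
    using assms unfolding distrib_right
    by (auto simp del: times_divide_eq_left intro!: add_nonneg_nonneg add_mono mult_left_mono mult_nonneg_nonneg)
qed

lemma Fmap_eq:
  assumes mesh: "\<And>j. j \<in> {1..\<kappa>} \<Longrightarrow> X (j - 1) < X j" and i: "i \<in> {1..\<kappa>}"
  shows "Fmap \<kappa> X ku km kf \<gamma> i =
    (kprim ku kf i (\<gamma> i) - kprim ku kf i (\<gamma> (i - 1))) / hlen X i -
    (if i < \<kappa> then (kprim ku kf (i + 1) (\<gamma> (i + 1)) - kprim ku kf (i + 1) (\<gamma> i)) / hlen X (i + 1) else 0)"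
proof -
  have Q: "Qflux \<kappa> X ku km kf j \<gamma> = (kprim ku kf j (\<gamma> j) - kprim ku kf j (\<gamma> (j - 1))) / hlen X j"
    if "j \<in> {1..\<kappa>}" for j
    by (rule Qflux_eq) (use mesh that in auto)
  show ?thesis using i by (auto simp: Fmap_def Q)
qed

lemma mat_vec_Mh: "i \<in> {1..\<kappa>} \<Longrightarrow> mat_vec \<kappa> (Mh \<kappa> X) v i = Mh \<kappa> X i i * v i"
  by (simp add: mat_vec_def Mh_def if_distrib[of "\<lambda>c. c * _"] sum.delta cong: if_cong)

section \<open>Column dominance of the discrete system, and its unique solvability\<close>

theorem theorem5p7:
  fixes \<kappa> :: nat and D :: real
    and X ku km kf cf cu L :: "nat \<Rightarrow> real"
    and \<theta> \<Delta>t sn sn1 :: real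
    and \<eta>n :: "nat \<Rightarrow> real"
    and \<Phi> :: "(nat \<Rightarrow> real) \<Rightarrow> (nat \<Rightarrow> real)"
  assumes "1 \<le> \<kappa>"
    and "X 0 = 0" and "X \<kappa> = D"
    and "\<And>j. j \<in> {1..\<kappa>} \<Longrightarrow> X (j - 1) < X j"
    and "\<And>i. i \<in> {1..\<kappa>} \<Longrightarrow> 0 < ku i \<and> 0 < km i \<and> 0 < kf i"
    and "\<And>i. i \<in> {1..\<kappa>} \<Longrightarrow> 0 < cf i \<and> 0 < cu i \<and> 0 < L i"
    and "\<theta> \<in> {0..1}" and "0 < \<Delta>t"
    and "\<eta>n \<in> topspace (Rvec \<kappa>)"
    and "\<Phi> = (\<lambda>x. \<lambda>i\<in>{1..\<kappa>}.
           1 / \<Delta>t * mat_vec \<kappa> (Mh \<kappa> X) (\<lambda>j\<in>{1..\<kappa>}. x j - \<eta>n j) i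
           + \<theta> * FDir \<kappa> X ku km kf sn1 (Bmap \<kappa> cf cu L x) i
           + (1 - \<theta>) * FDir \<kappa> X ku km kf sn (Bmap \<kappa> cf cu L \<eta>n) i)"
  shows "homeomorphic_map (Rvec \<kappa>) (Rvec \<kappa>) \<Phi> \<and>
    (\<exists>!\<eta>n1. \<eta>n1 \<in> topspace (Rvec \<kappa>) \<and>
       (\<forall>i\<in>{1..\<kappa>}.
          1 / \<Delta>t * mat_vec \<kappa> (Mh \<kappa> X) (\<lambda>j\<in>{1..\<kappa>}. \<eta>n1 j - \<eta>n j) i
          = - (1 - \<theta>) * FDir \<kappa> X ku km kf sn (Bmap \<kappa> cf cu L \<eta>n) i
            - \<theta> * FDir \<kappa> X ku km kf sn1 (Bmap \<kappa> cf cu L \<eta>n1) i))"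
proof -
  note mesh = assms(4)
  define I where "I = {1..\<kappa>}"
  have kpos: "0 \<le> ku i" "0 \<le> kf i" if "i \<in> I" for i
    using assms(5)[of i] that by (auto simp: I_def)
  have h: "0 < hlen X j" if "j \<in> I" for j
    using mesh[of j] that by (simp add: hlen_def I_def)
  define a where "a i = Mh \<kappa> X i i / \<Delta>t" for i
  \<comment> \<open>Up to sign, \<open>w j k\<close> is what the unknown at node \<open>j\<close>
    contributes to the flux through element \<open>k\<close>, weighted by \<open>\<theta>\<close>.
    It is used for \<open>k = j\<close> and \<open>k = j + 1\<close>, the elements meeting at node
    \<open>j\<close>.\<close>
  define w where "w j k t = \<theta> / hlen X k * kprim ku kf k (beta cf cu L t j)" for j k t
  define C where "C j k = \<theta> / hlen X k * ((ku k + kf k) * (1 / cf j + 1 / cu j))" for j k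
  define g where "g j t = w j j t + (if j < \<kappa> then w j (j + 1) t else 0)" for j t
  \<comment> \<open>Neighbouring nodes interact through the element between them, whose index is the
    larger of \<open>i\<close> and \<open>j\<close>.\<close>
  define p where "p i j t = (if i = j + 1 then w j i t else 0) + (if j = i + 1 then w j j t else 0)" for i j t
  \<comment> \<open>The Dirichlet value enters the first flux directly, not through
    \<open>beta\<close>. Being independent of the unknowns, it joins the old time level in the
    constant.\<close>
  define c where "c i = - a i * \<eta>n i - (if i = 1 then \<theta> / hlen X 1 * kprim ku kf 1 sn1 else 0)
    + (1 - \<theta>) * FDir \<kappa> X ku km kf sn (Bmap \<kappa> cf cu L \<eta>n) i" for i
  have w: "0 \<le> w j k t - w j k s" "w j k t - w j k s \<le> C j k * (t - s)"
    if j: "j \<in> I" and k: "k \<in> I" and st: "s \<le> t" for j k s t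
  proof -
    have cpos: "0 < cf j" "0 < cu j" "0 < L j" using assms(6)[of j] j by (auto simp: I_def)
    note b = beta_increment[of cf j cu L, OF cpos st]
    have le: "beta cf cu L s j \<le> beta cf cu L t j" using b(1) by simp
    note K = kprim_increment[of ku k kf, OF kpos[OF k] le]
    have coeff: "0 \<le> \<theta> / hlen X k" using h[OF k] assms(7) by simp
    have eq: "w j k t - w j k s = \<theta> / hlen X k *
        (kprim ku kf k (beta cf cu L t j) - kprim ku kf k (beta cf cu L s j))"
      by (simp add: w_def right_diff_distrib)
    show "0 \<le> w j k t - w j k s" unfolding eq using coeff K(1) by (rule mult_nonneg_nonneg)
    have "(ku k + kf k) * (beta cf cu L t j - beta cf cu L s j)
        \<le> (ku k + kf k) * ((1 / cf j + 1 / cu j) * (t - s))"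
      by (rule mult_left_mono[OF b(2)]) (use kpos[OF k] in simp)
    with K(2) have "kprim ku kf k (beta cf cu L t j) - kprim ku kf k (beta cf cu L s j)
        \<le> (ku k + kf k) * ((1 / cf j + 1 / cu j) * (t - s))" by (rule order_trans)
    from mult_left_mono[OF this coeff] show "w j k t - w j k s \<le> C j k * (t - s)"
      unfolding eq C_def by (simp only: mult.assoc)
  qed
  have row: "(\<Sum>j\<in>I. p i j (x j)) =
      (if i \<noteq> 1 then w (i - 1) i (x (i - 1)) else 0) + (if i < \<kappa> then w (i + 1) (i + 1) (x (i + 1)) else 0)"
    if i: "i \<in> I" for i x
  proof -
    \<comment> \<open>For \<open>i = 1\<close> the index \<open>i - 1\<close> is \<open>0\<close>,
      outside \<open>I\<close>: the boundary node contributes no column.\<close>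
    have "(\<Sum>j\<in>I. p i j (x j)) = (\<Sum>j\<in>I. if j = i - 1 then w j i (x j) else 0)
        + (\<Sum>j\<in>I. if j = i + 1 then w j j (x j) else 0)"
      unfolding p_def sum.distrib using i
      by (intro arg_cong2[of _ _ _ _ "(+)"] sum.cong) (auto simp: I_def)
    then show ?thesis using i by (auto simp: I_def sum.delta)
  qed
  have column: "(\<Sum>i\<in>I. p i j t - p i j s) =
      (if j < \<kappa> then w j (j + 1) t - w j (j + 1) s else 0) + (if j \<noteq> 1 then w j j t - w j j s else 0)"
    if j: "j \<in> I" for j s t
  proof -
    have "(\<Sum>i\<in>I. p i j t - p i j s) = (\<Sum>i\<in>I. if i = j + 1 then w j i t - w j i s else 0)
        + (\<Sum>i\<in>I. if i = j - 1 then w j j t - w j j s else 0)"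
      unfolding p_def sum.distrib[symmetric] using j by (intro sum.cong) (auto simp: I_def)
    then show ?thesis using j by (auto simp: I_def sum.delta)
  qed
  have \<Phi>: "\<Phi> x = (\<lambda>i\<in>I. a i * x i + g i (x i) - (\<Sum>j\<in>I. p i j (x j)) + c i)" for x
  proof
    fix i
    show "\<Phi> x i = (\<lambda>i\<in>I. a i * x i + g i (x i) - (\<Sum>j\<in>I. p i j (x j)) + c i) i"
    proof (cases "i \<in> I")
      case True
      then have i: "i \<in> {1..\<kappa>}" by (simp add: I_def)
      have Fmap_i: "Fmap \<kappa> X ku km kf \<gamma> i =
        (kprim ku kf i (\<gamma> i) - kprim ku kf i (\<gamma> (i - 1))) / hlen X i -
        (if i < \<kappa> then (kprim ku kf (i + 1) (\<gamma> (i + 1)) - kprim ku kf (i + 1) (\<gamma> i)) / hlen X (i + 1)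
         else 0)" for \<gamma>
        by (rule Fmap_eq) (use mesh i in auto)
      have F: "\<theta> * FDir \<kappa> X ku km kf sn1 (Bmap \<kappa> cf cu L x) i = g i (x i) - (\<Sum>j\<in>I. p i j (x j))
          - (if i = 1 then \<theta> / hlen X 1 * kprim ku kf 1 sn1 else 0)"
        unfolding FDir_def Fmap_i row[OF True] g_def w_def Bmap_def using i
        by (auto simp: diff_divide_distrib algebra_simps)
      have "mat_vec \<kappa> (Mh \<kappa> X) (\<lambda>j\<in>{1..\<kappa>}. x j - \<eta>n j) i = Mh \<kappa> X i i * (x i - \<eta>n i)"
        using mat_vec_Mh[OF i] i by simp
      then show ?thesis
        using True i F by (simp add: assms(10) a_def c_def diff_divide_distrib right_diff_distrib)
    next
      case False
      then show ?thesis by (simp only: assms(10) I_def[symmetric] restrict_apply if_False)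
    qed
  qed
  have homeo: "homeomorphic_map (Rvec \<kappa>) (Rvec \<kappa>) \<Phi>"
    unfolding I_def[symmetric]
  proof (rule homeomorphic_map_column_dominant)
    show "finite I" by (simp add: I_def)
    show "\<Phi> x = (\<lambda>i\<in>I. a i * x i + g i (x i) - (\<Sum>j\<in>I. p i j (x j)) + c i)" for x by (rule \<Phi>)
    show "0 < a i" if "i \<in> I" for i
      using h[of i] h[of "i + 1"] that assms(8) by (auto simp: a_def Mh_def I_def)
    show "mono (p i j)" if "i \<in> I" "j \<in> I" for i j
      using w(1)[OF that(2)] that by (auto simp: mono_def p_def)
    \<comment> \<open>Equality holds except for \<open>j = 1\<close>: the exchange with the boundary
      node appears in no row, so the column sum lacks the nonnegative increment of
      \<open>w 1 1\<close>.\<close>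
    show "(\<Sum>i\<in>I. p i j t - p i j s) \<le> g j t - g j s" if "j \<in> I" "s \<le> t" for j s t
      using w(1)[OF that(1) that(1) that(2)] unfolding column[OF that(1)] g_def by auto
    show "g j t - g j s \<le> (C j j + (if j < \<kappa> then C j (j + 1) else 0)) * (t - s)"
      if "j \<in> I" "s \<le> t" for j s t
      using w(2)[OF that(1) that(1) that(2)] w(2)[OF that(1) _ that(2), of "j + 1"] that
      by (auto simp: g_def distrib_right I_def)
  qed
  have zero: "(\<lambda>i\<in>{1..\<kappa>}. 0) \<in> topspace (Rvec \<kappa>)" by simp
  \<comment> \<open>With all terms on one side, the solutions of the system are the preimages of the
    origin under \<open>\<Phi>\<close>.\<close>
  have solves: "(\<forall>i\<in>{1..\<kappa>}.
      1 / \<Delta>t * mat_vec \<kappa> (Mh \<kappa> X) (\<lambda>j\<in>{1..\<kappa>}. x j - \<eta>n j) i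
      = - (1 - \<theta>) * FDir \<kappa> X ku km kf sn (Bmap \<kappa> cf cu L \<eta>n) i
        - \<theta> * FDir \<kappa> X ku km kf sn1 (Bmap \<kappa> cf cu L x) i) \<longleftrightarrow> \<Phi> x = (\<lambda>i\<in>{1..\<kappa>}. 0)" for x
    unfolding assms(10) restrict_def fun_eq_iff by (auto simp: algebra_simps)
  have "\<exists>!x. x \<in> topspace (Rvec \<kappa>) \<and> \<Phi> x = (\<lambda>i\<in>{1..\<kappa>}. 0)"
  proof (rule ex_ex1I)
    have "\<Phi> ` topspace (Rvec \<kappa>) = topspace (Rvec \<kappa>)"
      using homeo by (rule homeomorphic_imp_surjective_map)
    with zero have "(\<lambda>i\<in>{1..\<kappa>}. 0) \<in> \<Phi> ` topspace (Rvec \<kappa>)" by (simp only:)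
    then show "\<exists>x. x \<in> topspace (Rvec \<kappa>) \<and> \<Phi> x = (\<lambda>i\<in>{1..\<kappa>}. 0)" by (metis imageE)
    show "x = y" if "x \<in> topspace (Rvec \<kappa>) \<and> \<Phi> x = (\<lambda>i\<in>{1..\<kappa>}. 0)"
      "y \<in> topspace (Rvec \<kappa>) \<and> \<Phi> y = (\<lambda>i\<in>{1..\<kappa>}. 0)" for x y
      using inj_onD[OF homeomorphic_imp_injective_map[OF homeo]] that by metis
  qed
  with homeo show ?thesis unfolding solves by (rule conjI)
qed

end
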